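(* Let $(M^{2n+1},\phi,\xi,\eta,g)$ be an almost $\alpha$-paracosymplectic manifold and let $\mathcal{A}X=-\nabla_X\xi$. Then $$\mathcal{A}\phi+\phi\mathcal{A}=-2\alpha\phi,\qquad \nabla_\xi\phi=0 .$$
   Context: An almost paracontact metric manifold is a smooth manifold $M$ of dimension $2n+1$ with a $(1,1)$-tensor field $\phi$, a vector field $\xi$, a 1-form $\eta$ and a pseudo-Riemannian metric $g$ of signature $(n+1,n)$ such that $\eta(\xi)=1$, $\phi^2=\mathrm{Id}-\eta\otimes\xi$, the eigendistributions of $\phi|_{\ker\eta}$ for the eigenvalues $+1$ and $-1$ both have rank $n$, and $g(\phi X,\phi Y)=-g(X,Y)+\eta(X)\eta(Y)$ (hence $\eta(X)=g(X,\xi)$, $\phi\xi=0$, $\eta\circ\phi=0$). Its fundamental 2-form is $\Phi(X,Y)=g(\phi X,Y)$. It is almost $\alpha$-paracosymplectic, where $\alpha$ is a smooth real function on $M$ (possibly constant), if $d\eta=0$ and $d\Phi=2\alpha\,\eta\wedge\Phi$ (with $d$ and $\wedge$ normalized compatibly, so that the cyclic sum of $(\nabla_X\Phi)(Y,Z)$ equals $2\alpha$ times the cyclic sum of $\eta(X)\Phi(Y,Z)$). $\nabla$ is the Levi-Civita connection of $g$. *)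

theory Defs
  imports "HOL-Analysis.Analysis" "HOL-Library.Function_Algebras"
begin

instantiation "fun" :: (type, real_vector) real_vector
begin

definition "c *\<^sub>R f = (\<lambda>x. c *\<^sub>R f x)"

instance
  by standard (simp_all add: scaleR_fun_def fun_eq_iff algebra_simps)

end

lemma scaleR_fun_apply [simp]: "(c *\<^sub>R f) x = c *\<^sub>R f x"
  by (simp add: scaleR_fun_def)

text \<open>Only used for open \<open>S\<close>, so that the derivative at each point of \<open>S\<close> is unique.\<close>

fun C_k_on :: "nat \<Rightarrow> 'v::real_normed_vector set \<Rightarrow> ('v \<Rightarrow> 'w::real_normed_vector) \<Rightarrow> bool" where
  "C_k_on 0 S f \<longleftrightarrow> continuous_on S f"
| "C_k_on (Suc k) S f \<longleftrightarrow> (\<forall>x\<in>S. f differentiable at x) \<and>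
     (\<forall>w. C_k_on k S (\<lambda>x. frechet_derivative f (at x) w))"

definition smooth_on :: "'v::real_normed_vector set \<Rightarrow> ('v \<Rightarrow> 'w::real_normed_vector) \<Rightarrow> bool" where
  "smooth_on S f \<longleftrightarrow> (\<forall>k. C_k_on k S f)"

text \<open>The manifold is the whole type \<open>'a\<close>. A chart is its domain together with its coordinate
  map, whose values outside the domain are irrelevant.\<close>

type_synonym ('a, 'e) chart = "'a set \<times> ('a \<Rightarrow> 'e)"

definition smooth_atlas ::
  "('a::{t2_space, second_countable_topology}, 'e::euclidean_space) chart set \<Rightarrow> bool" where
  "smooth_atlas A \<longleftrightarrow>
     (\<Union>(U, \<psi>)\<in>A. U) = UNIV \<and>
     (\<forall>(U, \<psi>)\<in>A. open U \<and> open (\<psi> ` U) \<and> inj_on \<psi> U \<and>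
        homeomorphism U (\<psi> ` U) \<psi> (inv_into U \<psi>)) \<and>
     (\<forall>(U, \<psi>)\<in>A. \<forall>(V, \<theta>)\<in>A. smooth_on (\<psi> ` (U \<inter> V)) (\<theta> \<circ> inv_into U \<psi>))"

definition smooth_functions ::
  "('a::topological_space, 'e::euclidean_space) chart set \<Rightarrow> ('a \<Rightarrow> real) set" where
  "smooth_functions A = {f. \<forall>(U, \<psi>)\<in>A. smooth_on (\<psi> ` U) (f \<circ> inv_into U \<psi>)}"

text \<open>Tangent vectors at \<open>p\<close> are the directional derivatives at \<open>p\<close>, as operators on the smooth
  functions. They take the value 0 outside the smooth functions, to make equality extensional.\<close>

type_synonym 'a tvec = "('a \<Rightarrow> real) \<Rightarrow> real"

definition tangent_space ::
  "('a::topological_space, 'e::euclidean_space) chart set \<Rightarrow> 'a \<Rightarrow> 'a tvec set" where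
  "tangent_space A p = {v. (\<forall>f. f \<notin> smooth_functions A \<longrightarrow> v f = 0) \<and>
     (\<exists>(U, \<psi>)\<in>A. p \<in> U \<and> (\<exists>w. \<forall>f\<in>smooth_functions A.
        v f = frechet_derivative (f \<circ> inv_into U \<psi>) (at (\<psi> p)) w))}"

type_synonym 'a vfield = "'a \<Rightarrow> 'a tvec"

definition lie_deriv :: "'a vfield \<Rightarrow> ('a \<Rightarrow> real) \<Rightarrow> 'a \<Rightarrow> real" where
  "lie_deriv X f = (\<lambda>p. X p f)"

definition vector_fields ::
  "('a::topological_space, 'e::euclidean_space) chart set \<Rightarrow> 'a vfield set" where
  "vector_fields A = {X. (\<forall>p. X p \<in> tangent_space A p) \<and>
     (\<forall>f\<in>smooth_functions A. lie_deriv X f \<in> smooth_functions A)}"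

definition lie_bracket :: "'a vfield \<Rightarrow> 'a vfield \<Rightarrow> 'a vfield" where
  "lie_bracket X Y = (\<lambda>p f. X p (lie_deriv Y f) - Y p (lie_deriv X f))"

definition fscale :: "('a \<Rightarrow> real) \<Rightarrow> 'a vfield \<Rightarrow> 'a vfield" where
  "fscale f X = (\<lambda>p. f p *\<^sub>R X p)"

definition linear_on_space :: "'v::real_vector set \<Rightarrow> ('v \<Rightarrow> 'w::real_vector) \<Rightarrow> bool" where
  "linear_on_space V L \<longleftrightarrow> (\<forall>u\<in>V. \<forall>v\<in>V. L (u + v) = L u + L v) \<and>
     (\<forall>c. \<forall>v\<in>V. L (c *\<^sub>R v) = c *\<^sub>R L v)"

type_synonym 'a form1 = "'a \<Rightarrow> 'a tvec \<Rightarrow> real"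
type_synonym 'a form2 = "'a \<Rightarrow> 'a tvec \<Rightarrow> 'a tvec \<Rightarrow> real"
type_synonym 'a form3 = "'a \<Rightarrow> 'a tvec \<Rightarrow> 'a tvec \<Rightarrow> 'a tvec \<Rightarrow> real"
type_synonym 'a endo = "'a \<Rightarrow> 'a tvec \<Rightarrow> 'a tvec"

definition app_endo :: "'a endo \<Rightarrow> 'a vfield \<Rightarrow> 'a vfield" where
  "app_endo \<phi> X = (\<lambda>p. \<phi> p (X p))"

definition app1 :: "'a form1 \<Rightarrow> 'a vfield \<Rightarrow> 'a \<Rightarrow> real" where
  "app1 \<eta> X = (\<lambda>p. \<eta> p (X p))"

definition app2 :: "'a form2 \<Rightarrow> 'a vfield \<Rightarrow> 'a vfield \<Rightarrow> 'a \<Rightarrow> real" where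
  "app2 g X Y = (\<lambda>p. g p (X p) (Y p))"

definition endo_field ::
  "('a::topological_space, 'e::euclidean_space) chart set \<Rightarrow> 'a endo \<Rightarrow> bool" where
  "endo_field A \<phi> \<longleftrightarrow>
     (\<forall>p. linear_on_space (tangent_space A p) (\<phi> p) \<and>
        \<phi> p ` tangent_space A p \<subseteq> tangent_space A p) \<and>
     (\<forall>X\<in>vector_fields A. app_endo \<phi> X \<in> vector_fields A)"

definition one_form ::
  "('a::topological_space, 'e::euclidean_space) chart set \<Rightarrow> 'a form1 \<Rightarrow> bool" where
  "one_form A \<eta> \<longleftrightarrow>
     (\<forall>p. linear_on_space (tangent_space A p) (\<eta> p)) \<and>
     (\<forall>X\<in>vector_fields A. app1 \<eta> X \<in> smooth_functions A)"

definition pseudo_riemannian_metric ::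
  "('a::topological_space, 'e::euclidean_space) chart set \<Rightarrow> 'a form2 \<Rightarrow> bool" where
  "pseudo_riemannian_metric A g \<longleftrightarrow>
     (\<forall>p. (\<forall>u\<in>tangent_space A p. linear_on_space (tangent_space A p) (g p u)) \<and>
        (\<forall>u\<in>tangent_space A p. \<forall>v\<in>tangent_space A p. g p u v = g p v u) \<and>
        (\<forall>u\<in>tangent_space A p. (\<forall>v\<in>tangent_space A p. g p u v = 0) \<longrightarrow> u = 0)) \<and>
     (\<forall>X\<in>vector_fields A. \<forall>Y\<in>vector_fields A. app2 g X Y \<in> smooth_functions A)"

text \<open>Signature \<open>(r, s)\<close>: every tangent space has a pseudo-orthonormal basis with \<open>r\<close> vectors of
  square 1 and \<open>s\<close> vectors of square -1.\<close>

definition has_signature ::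
  "('a::topological_space, 'e::euclidean_space) chart set \<Rightarrow> 'a form2 \<Rightarrow> nat \<Rightarrow> nat \<Rightarrow> bool" where
  "has_signature A g r s \<longleftrightarrow> (\<forall>p. \<exists>b :: nat \<Rightarrow> 'a tvec.
     span (b ` {..<r + s}) = tangent_space A p \<and>
     (\<forall>i<r + s. \<forall>j<r + s. g p (b i) (b j) = (if i = j then (if i < r then 1 else -1) else 0)))"

text \<open>Exterior derivative and wedge product without the factors \<open>1 / (k + 1)\<close>, that is, in the
  convention in which \<open>d\<Phi>\<close> is the cyclic sum of \<open>(\<nabla>\<^sub>X\<Phi>)(Y, Z)\<close> for a torsion-free connection, and
  \<open>\<eta> \<and> \<Phi>\<close> is the cyclic sum of \<open>\<eta>(X)\<Phi>(Y, Z)\<close>.\<close>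

definition d_form1 :: "'a form1 \<Rightarrow> 'a vfield \<Rightarrow> 'a vfield \<Rightarrow> 'a \<Rightarrow> real" where
  "d_form1 \<eta> X Y = (\<lambda>p. lie_deriv X (app1 \<eta> Y) p - lie_deriv Y (app1 \<eta> X) p
     - app1 \<eta> (lie_bracket X Y) p)"

definition d_form2 :: "'a form2 \<Rightarrow> 'a vfield \<Rightarrow> 'a vfield \<Rightarrow> 'a vfield \<Rightarrow> 'a \<Rightarrow> real" where
  "d_form2 \<Phi> X Y Z = (\<lambda>p.
     lie_deriv X (app2 \<Phi> Y Z) p - lie_deriv Y (app2 \<Phi> X Z) p + lie_deriv Z (app2 \<Phi> X Y) p
     - app2 \<Phi> (lie_bracket X Y) Z p + app2 \<Phi> (lie_bracket X Z) Y p
     - app2 \<Phi> (lie_bracket Y Z) X p)"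

definition wedge12 :: "'a form1 \<Rightarrow> 'a form2 \<Rightarrow> 'a form3" where
  "wedge12 \<eta> \<Phi> = (\<lambda>p u v w. \<eta> p u * \<Phi> p v w - \<eta> p v * \<Phi> p u w + \<eta> p w * \<Phi> p u v)"

type_synonym 'a connection = "'a vfield \<Rightarrow> 'a vfield \<Rightarrow> 'a vfield"

text \<open>\<open>D X Y\<close> is \<open>\<nabla>\<^sub>X Y\<close>; it is only constrained on smooth vector fields.\<close>

definition affine_connection ::
  "('a::topological_space, 'e::euclidean_space) chart set \<Rightarrow> 'a connection \<Rightarrow> bool" where
  "affine_connection A D \<longleftrightarrow>
     (\<forall>X\<in>vector_fields A. \<forall>Y\<in>vector_fields A. D X Y \<in> vector_fields A) \<and>
     (\<forall>X\<in>vector_fields A. \<forall>Y\<in>vector_fields A. \<forall>Z\<in>vector_fields A.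
        D (X + Y) Z = D X Z + D Y Z \<and> D X (Y + Z) = D X Y + D X Z) \<and>
     (\<forall>f\<in>smooth_functions A. \<forall>X\<in>vector_fields A. \<forall>Y\<in>vector_fields A.
        D (fscale f X) Y = fscale f (D X Y) \<and>
        D X (fscale f Y) = fscale (lie_deriv X f) Y + fscale f (D X Y))"

definition levi_civita_connection ::
  "('a::topological_space, 'e::euclidean_space) chart set \<Rightarrow> 'a form2 \<Rightarrow> 'a connection \<Rightarrow> bool" where
  "levi_civita_connection A g D \<longleftrightarrow> affine_connection A D \<and>
     (\<forall>X\<in>vector_fields A. \<forall>Y\<in>vector_fields A. D X Y - D Y X = lie_bracket X Y) \<and>
     (\<forall>X\<in>vector_fields A. \<forall>Y\<in>vector_fields A. \<forall>Z\<in>vector_fields A. \<forall>p.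
        lie_deriv X (app2 g Y Z) p = app2 g (D X Y) Z p + app2 g Y (D X Z) p)"

definition cov_deriv_endo :: "'a connection \<Rightarrow> 'a vfield \<Rightarrow> 'a endo \<Rightarrow> 'a vfield \<Rightarrow> 'a vfield" where
  "cov_deriv_endo D X \<phi> Y = D X (app_endo \<phi> Y) - app_endo \<phi> (D X Y)"

definition fundamental_form :: "'a endo \<Rightarrow> 'a form2 \<Rightarrow> 'a form2" where
  "fundamental_form \<phi> g = (\<lambda>p u v. g p (\<phi> p u) v)"

definition almost_paracontact_metric ::
  "('a::{t2_space, second_countable_topology}, 'e::euclidean_space) chart set \<Rightarrow> nat \<Rightarrow>
   'a endo \<Rightarrow> 'a vfield \<Rightarrow> 'a form1 \<Rightarrow> 'a form2 \<Rightarrow> bool" where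
  "almost_paracontact_metric A n \<phi> \<xi> \<eta> g \<longleftrightarrow>
     smooth_atlas A \<and> DIM('e) = 2 * n + 1 \<and>
     endo_field A \<phi> \<and> \<xi> \<in> vector_fields A \<and> one_form A \<eta> \<and>
     pseudo_riemannian_metric A g \<and> has_signature A g (n + 1) n \<and>
     (\<forall>p. \<eta> p (\<xi> p) = 1 \<and>
        (\<forall>v\<in>tangent_space A p. \<phi> p (\<phi> p v) = v - \<eta> p v *\<^sub>R \<xi> p) \<and>
        dim {v \<in> tangent_space A p. \<eta> p v = 0 \<and> \<phi> p v = v} = n \<and>
        dim {v \<in> tangent_space A p. \<eta> p v = 0 \<and> \<phi> p v = - v} = n \<and>
        (\<forall>u\<in>tangent_space A p. \<forall>v\<in>tangent_space A p.
           g p (\<phi> p u) (\<phi> p v) = - g p u v + \<eta> p u * \<eta> p v))"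

definition almost_paracosymplectic ::
  "('a::{t2_space, second_countable_topology}, 'e::euclidean_space) chart set \<Rightarrow> nat \<Rightarrow>
   'a endo \<Rightarrow> 'a vfield \<Rightarrow> 'a form1 \<Rightarrow> 'a form2 \<Rightarrow> ('a \<Rightarrow> real) \<Rightarrow> bool" where
  "almost_paracosymplectic A n \<phi> \<xi> \<eta> g \<alpha> \<longleftrightarrow>
     almost_paracontact_metric A n \<phi> \<xi> \<eta> g \<and> \<alpha> \<in> smooth_functions A \<and>
     (\<forall>X\<in>vector_fields A. \<forall>Y\<in>vector_fields A. \<forall>p. d_form1 \<eta> X Y p = 0) \<and>
     (\<forall>X\<in>vector_fields A. \<forall>Y\<in>vector_fields A. \<forall>Z\<in>vector_fields A. \<forall>p.
        d_form2 (fundamental_form \<phi> g) X Y Z p =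
          2 * \<alpha> p * wedge12 \<eta> (fundamental_form \<phi> g) p (X p) (Y p) (Z p))"

definition shape_operator :: "'a connection \<Rightarrow> 'a vfield \<Rightarrow> 'a vfield \<Rightarrow> 'a vfield" where
  "shape_operator D \<xi> X = - D X \<xi>"

end

theory Submission
  imports Defs
begin

text \<open>Let \<open>h(X, Y) = g(\<nabla>\<^sub>X\<xi>, Y) = - g(\<A>X, Y)\<close> and \<open>F(Y, Z) = g((\<nabla>\<^sub>\<xi>\<phi>)Y, Z)\<close>. Since \<open>\<eta>\<close> is closed and
  \<open>\<xi>\<close> has constant length, \<open>h\<close> is symmetric and \<open>\<xi>\<close> lies in its kernel (\<open>nabla_xi_symmetric\<close>,
  \<open>nabla_xi_orthogonal\<close>, \<open>nabla_xi_xi\<close>). Evaluating \<open>d\<Phi> = 2\<alpha> \<eta> \<and> \<Phi>\<close> on \<open>(\<xi>, Y, Z)\<close> with the torsion-free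
  metric connection gives (\<open>d_Phi_along_xi\<close>)

    \<open>F(Y, Z) - h(Y, \<phi>Z) + h(Z, \<phi>Y) = 2\<alpha> \<Phi>(Y, Z)\<close>.

  Replace \<open>Y\<close> and \<open>Z\<close> by \<open>\<phi>Y\<close> and \<open>\<phi>Z\<close>. The first term does not change, because \<open>\<phi>\<^sup>2\<close> is the identity
  up to multiples of \<open>\<xi>\<close> and \<open>\<xi>\<close> is parallel along itself (\<open>g_nabla_xi_phi_invariant\<close>); the right-hand
  side changes sign, because \<open>\<Phi>(\<phi>Y, \<phi>Z) = - \<Phi>(Y, Z)\<close>; and the \<open>h\<close> terms change sign by the
  symmetry of \<open>h\<close>, whose kernel absorbs the multiples of \<open>\<xi>\<close>. Adding
  the two equations leaves \<open>2F(Y, Z) = 0\<close>. The first equation then reads \<open>h(Z, \<phi>Y) - h(Y, \<phi>Z) = 2\<alpha> \<Phi>(Y, Z)\<close>, which is the formula for the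
  anticommutator of \<open>\<A>\<close> and \<open>\<phi>\<close> paired with \<open>Z\<close>.

  All of this tests vectors against global vector fields, whereas nondegeneracy of \<open>g\<close> is a statement
  about one tangent space. For an indefinite metric it matters that every tangent vector is the value of
  a vector field: a subspace of test vectors could be isotropic. That is \<open>tangent_vector_extends\<close>, for
  which a coordinate field is cut off by a bump function; the closure properties of smooth functions
  that this needs come first.\<close>

section \<open>Calculus of smooth functions on open sets\<close>

lemma C_k_on_subset: "C_k_on k S f \<Longrightarrow> T \<subseteq> S \<Longrightarrow> C_k_on k T f"
  by (induction k arbitrary: f) (auto intro: continuous_on_subset)

lemma frechet_derivative_eqI: "(f has_derivative F) (at x) \<Longrightarrow> frechet_derivative f (at x) w = F w"
  by (metis frechet_derivative_at)

text \<open>Being \<open>C\<^sup>k\<close> on an open set depends on the values there only, although the derivatives in the definition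
  are taken of the function on the whole space.\<close>

lemma C_k_on_cong:
  assumes "open S" "C_k_on k S f" "\<And>x. x \<in> S \<Longrightarrow> f x = g x"
  shows "C_k_on k S g"
  using assms(2,3)
proof (induction k arbitrary: f g)
  case 0
  then show ?case by (metis C_k_on.simps(1) continuous_on_cong)
next
  case (Suc k)
  have D: "(g has_derivative frechet_derivative f (at x)) (at x)" if "x \<in> S" for x
  proof -
    have "(f has_derivative frechet_derivative f (at x)) (at x)"
      using Suc.prems(1) that frechet_derivative_works by auto
    then show ?thesis
      by (rule has_derivative_transform_within_open[OF _ assms(1) that]) (use Suc.prems(2) in auto)
  qed
  have "C_k_on k S (\<lambda>x. frechet_derivative g (at x) w)" for w
    by (rule Suc.IH[of "\<lambda>x. frechet_derivative f (at x) w"])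
       (use Suc.prems(1) D frechet_derivative_eqI in \<open>auto simp: frechet_derivative_eqI[OF D]\<close>)
  with D show ?case by (auto simp: differentiable_def)
qed

text \<open>Induction step for the sums, products and compositions below: any family of derivatives that is \<open>C\<^sup>k\<close> in
  each direction may stand for the Frechet derivatives.\<close>

lemma C_k_on_SucI:
  assumes "open S" "\<And>x. x \<in> S \<Longrightarrow> (f has_derivative F x) (at x)" "\<And>w. C_k_on k S (\<lambda>x. F x w)"
  shows "C_k_on (Suc k) S f"
proof -
  have "C_k_on k S (\<lambda>x. frechet_derivative f (at x) w)" for w
    by (rule C_k_on_cong[OF assms(1) assms(3)[of w]])
       (use assms(2) in \<open>simp add: frechet_derivative_eqI[OF assms(2)]\<close>)
  with assms(2) show ?thesis by (auto simp: differentiable_def)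
qed

lemma C_k_on_SucD:
  assumes "C_k_on (Suc k) S f" "x \<in> S"
  shows "(f has_derivative frechet_derivative f (at x)) (at x)"
  using assms frechet_derivative_works by auto

lemma C_k_on_Un:
  assumes "open S" "open T" "C_k_on k S f" "C_k_on k T f"
  shows "C_k_on k (S \<union> T) f"
  using assms(3,4)
  by (induction k arbitrary: f) (auto intro: continuous_on_open_Un assms(1,2))

lemma C_k_on_lower: "C_k_on (Suc k) S f \<Longrightarrow> C_k_on k S f"
proof (induction k arbitrary: f)
  case 0
  then show ?case
    by (auto intro!: differentiable_imp_continuous_on differentiable_at_imp_differentiable_on)
next
  case (Suc k)
  then show ?case by auto
qed

lemma C_k_on_const: "C_k_on k S (\<lambda>_. c)"
  by (induction k arbitrary: c) auto

lemma C_k_on_bounded_linear: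
  assumes "bounded_linear L" shows "C_k_on k S L"
proof (cases k)
  case 0
  then show ?thesis using assms by (simp add: linear_continuous_on)
next
  case (Suc m)
  have D: "(L has_derivative L) (at x)" for x
    by (rule bounded_linear_imp_has_derivative[OF assms])
  show ?thesis
    unfolding Suc by (auto simp: frechet_derivative_eqI[OF D] C_k_on_const)
      (use D in \<open>auto simp: differentiable_def\<close>)
qed

lemma C_k_on_add:
  assumes "open S" "C_k_on k S f" "C_k_on k S g"
  shows "C_k_on k S (\<lambda>x. f x + g x)"
  using assms(2,3)
proof (induction k arbitrary: f g)
  case 0
  then show ?case by (simp add: continuous_on_add)
next
  case (Suc k)
  show ?case
  proof (rule C_k_on_SucI[OF assms(1)])
    show "((\<lambda>x. f x + g x) has_derivative
      (\<lambda>w. frechet_derivative f (at x) w + frechet_derivative g (at x) w)) (at x)" if "x \<in> S" for x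
      using Suc.prems that by (intro has_derivative_add C_k_on_SucD)
    show "C_k_on k S (\<lambda>x. frechet_derivative f (at x) w + frechet_derivative g (at x) w)" for w
      by (rule Suc.IH) (use Suc.prems in auto)
  qed
qed

lemma C_k_on_sum:
  assumes "open S" "finite I" "\<And>i. i \<in> I \<Longrightarrow> C_k_on k S (f i)"
  shows "C_k_on k S (\<lambda>x. \<Sum>i\<in>I. f i x)"
  using assms(2,3)
  by (induction I rule: finite_induct) (auto intro: C_k_on_const C_k_on_add[OF assms(1)])

lemma C_k_on_mult:
  fixes f g :: "'v::real_normed_vector \<Rightarrow> real"
  assumes "open S" "C_k_on k S f" "C_k_on k S g"
  shows "C_k_on k S (\<lambda>x. f x * g x)"
  using assms(2,3)
proof (induction k arbitrary: f g)
  case 0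
  then show ?case by (simp add: continuous_on_mult)
next
  case (Suc k)
  show ?case
  proof (rule C_k_on_SucI[OF assms(1)])
    show "((\<lambda>x. f x * g x) has_derivative
      (\<lambda>w. f x * frechet_derivative g (at x) w + frechet_derivative f (at x) w * g x)) (at x)"
      if "x \<in> S" for x
      using Suc.prems that by (intro has_derivative_mult C_k_on_SucD)
    have low: "C_k_on k S f" "C_k_on k S g" using Suc.prems by (auto intro: C_k_on_lower)
    show "C_k_on k S (\<lambda>x. f x * frechet_derivative g (at x) w
        + frechet_derivative f (at x) w * g x)" for w
      by (intro C_k_on_add[OF assms(1)] Suc.IH) (use Suc.prems low in auto)
  qed
qed

lemma C_k_on_inner_const:
  fixes f :: "'v::real_normed_vector \<Rightarrow> 'e::real_inner"
  assumes "open S" "C_k_on k S f"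
  shows "C_k_on k S (\<lambda>x. f x \<bullet> i)"
  using assms(2)
proof (induction k arbitrary: f)
  case 0
  then show ?case by (simp add: continuous_on_inner)
next
  case (Suc k)
  show ?case
  proof (rule C_k_on_SucI[OF assms(1)])
    show "((\<lambda>x. f x \<bullet> i) has_derivative (\<lambda>w. frechet_derivative f (at x) w \<bullet> i)) (at x)"
      if "x \<in> S" for x
      using Suc.prems that by (intro has_derivative_inner_left C_k_on_SucD)
    show "C_k_on k S (\<lambda>x. frechet_derivative f (at x) w \<bullet> i)" for w
      by (rule Suc.IH) (use Suc.prems in auto)
  qed
qed

text \<open>The chain rule writes the derivative of \<open>f \<circ> T\<close> in direction \<open>w\<close> as a contraction of \<open>DT(x)w\<close> with \<open>Df(T x)\<close>.
  The induction hypothesis speaks of derivatives of \<open>f\<close> in fixed directions, so \<open>DT(x)w\<close> is expanded in an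
  orthonormal basis.\<close>

lemma C_k_on_compose:
  fixes f :: "'e::euclidean_space \<Rightarrow> real" and T :: "'v::real_normed_vector \<Rightarrow> 'e"
  assumes "open S" "T ` S \<subseteq> S'" "C_k_on k S' f" "C_k_on k S T"
  shows "C_k_on k S (\<lambda>x. f (T x))"
  using assms(3,4)
proof (induction k arbitrary: f)
  case 0
  then show ?case using assms(2) by (auto intro: continuous_on_compose2)
next
  case (Suc k)
  show ?case
  proof (rule C_k_on_SucI[OF assms(1)])
    fix x assume x: "x \<in> S"
    have T: "(T has_derivative frechet_derivative T (at x)) (at x)"
      using Suc.prems x by (intro C_k_on_SucD)
    have f: "(f has_derivative frechet_derivative f (at (T x))) (at (T x))"
      using Suc.prems x assms(2) by (intro C_k_on_SucD) auto
    have lin: "linear (frechet_derivative f (at (T x)))"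
      using f by (rule has_derivative_linear)
    have "frechet_derivative f (at (T x)) (frechet_derivative T (at x) w) =
      (\<Sum>i\<in>Basis. (frechet_derivative T (at x) w \<bullet> i) * frechet_derivative f (at (T x)) i)" for w
      by (subst euclidean_representation[symmetric])
         (simp add: linear_sum[OF lin] linear_cmul[OF lin])
    then show "((\<lambda>x. f (T x)) has_derivative (\<lambda>w. \<Sum>i\<in>Basis.
        (frechet_derivative T (at x) w \<bullet> i) * frechet_derivative f (at (T x)) i)) (at x)"
      using has_derivative_compose[OF T f] by simp
  next
    have "C_k_on k S (\<lambda>x. frechet_derivative f (at (T x)) i)" for i
      by (rule Suc.IH) (use Suc.prems in \<open>auto intro: C_k_on_lower\<close>)
    then show "C_k_on k S (\<lambda>x. \<Sum>i\<in>Basis.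
        (frechet_derivative T (at x) w \<bullet> i) * frechet_derivative f (at (T x)) i)" for w
      by (intro C_k_on_sum C_k_on_mult C_k_on_inner_const assms(1) finite_Basis)
         (use Suc.prems in auto)
  qed
qed

lemma smooth_on_mult:
  fixes f g :: "'v::real_normed_vector \<Rightarrow> real"
  shows "open S \<Longrightarrow> smooth_on S f \<Longrightarrow> smooth_on S g \<Longrightarrow> smooth_on S (\<lambda>x. f x * g x)"
  unfolding smooth_on_def by (blast intro: C_k_on_mult)

lemma smooth_on_directional_derivative:
  "smooth_on S f \<Longrightarrow> smooth_on S (\<lambda>x. frechet_derivative f (at x) w)"
  unfolding smooth_on_def by (metis C_k_on.simps(2))

lemma smooth_on_has_derivative:
  "smooth_on S f \<Longrightarrow> x \<in> S \<Longrightarrow> (f has_derivative frechet_derivative f (at x)) (at x)"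
  unfolding smooth_on_def by (rule C_k_on_SucD) auto

section \<open>Bump functions\<close>

text \<open>The functions \<open>t\<^sup>-\<^sup>n exp(-1/t)\<close>, continued by 0 to \<open>t \<le> 0\<close>. Only \<open>n = 0\<close> is wanted, but the whole family is
  closed under differentiation up to linear combinations, so that smoothness is an induction over all
  members at once.\<close>

definition flat_exp :: "nat \<Rightarrow> real \<Rightarrow> real" where
  "flat_exp n t = (if t > 0 then inverse t ^ n * exp (- inverse t) else 0)"

lemma flat_exp_tendsto_0: "(flat_exp n \<longlongrightarrow> 0) (at 0)"
proof -
  have "((\<lambda>t. inverse t ^ n / exp (inverse t)) \<longlongrightarrow> (0::real)) (at_right 0)"
    by (rule filterlim_compose[OF tendsto_power_div_exp_0 filterlim_inverse_at_top_right])
  moreover have "\<forall>\<^sub>F t in at_right 0. inverse t ^ n / exp (inverse t) = flat_exp n t"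
    by (auto simp: eventually_at_right_field flat_exp_def exp_minus divide_simps intro: exI[of _ 1])
  ultimately have "(flat_exp n \<longlongrightarrow> 0) (at_right 0)"
    by (rule Lim_transform_eventually)
  moreover have "(flat_exp n \<longlongrightarrow> 0) (at_left 0)"
    by (rule tendsto_eventually)
       (auto simp: eventually_at_left_field flat_exp_def intro: exI[of _ "-1"])
  ultimately show ?thesis by (simp add: filterlim_split_at)
qed

text \<open>At 0 the difference quotient of a member is the next member of the family, which tends to 0.\<close>

lemma flat_exp_has_field_derivative:
  "(flat_exp n has_field_derivative - of_nat n * flat_exp (Suc n) t + flat_exp (Suc (Suc n)) t) (at t)"
proof -
  consider "t > 0" | "t < 0" | "t = 0" by linarith
  then show ?thesis
  proof cases
    case 1
    have "((\<lambda>t. inverse t ^ n * exp (- inverse t)) has_field_derivative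
      - of_nat n * flat_exp (Suc n) t + flat_exp (Suc (Suc n)) t) (at t)"
      using 1 power_eq_if[of "inverse t" "n - 1"]
      by (cases n) (auto intro!: derivative_eq_intros simp: flat_exp_def algebra_simps split: if_splits)
    then show ?thesis
      by (rule has_field_derivative_transform_within_open[where S = "{0<..}"])
         (use 1 in \<open>auto simp: flat_exp_def\<close>)
  next
    case 2
    have "((\<lambda>t. 0) has_field_derivative
      - of_nat n * flat_exp (Suc n) t + flat_exp (Suc (Suc n)) t) (at t)"
      using 2 by (auto simp: flat_exp_def)
    then show ?thesis
      by (rule has_field_derivative_transform_within_open[where S = "{..<0}"])
         (use 2 in \<open>auto simp: flat_exp_def\<close>)
  next
    case 3
    have "(\<lambda>h. (flat_exp n (0 + h) - flat_exp n 0) / h) = flat_exp (Suc n)"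
      by (auto simp: flat_exp_def fun_eq_iff divide_simps)
    then have "(flat_exp n has_field_derivative 0) (at 0)"
      using flat_exp_tendsto_0[of "Suc n"] by (simp add: DERIV_def)
    then show ?thesis using 3 by (simp add: flat_exp_def)
  qed
qed

lemma C_k_on_flat_exp: "C_k_on k UNIV (flat_exp n)"
proof (induction k arbitrary: n)
  case 0
  then show ?case
    by (auto intro!: continuous_at_imp_continuous_on DERIV_isCont[OF flat_exp_has_field_derivative])
next
  case (Suc k)
  show ?case
  proof (rule C_k_on_SucI)
    show "(flat_exp n has_derivative
      (\<lambda>w. (- of_nat n * flat_exp (Suc n) t + flat_exp (Suc (Suc n)) t) * w)) (at t)" for t
      using flat_exp_has_field_derivative[of n t] by (simp add: has_field_derivative_def)
    show "C_k_on k UNIV (\<lambda>t. (- of_nat n * flat_exp (Suc n) t + flat_exp (Suc (Suc n)) t) * w)" for w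
      by (intro C_k_on_mult C_k_on_add C_k_on_const Suc.IH open_UNIV)
  qed auto
qed

text \<open>Up to a normalisation, the bump function is \<open>flat_exp 0\<close> applied to \<open>r\<^sup>2 - |x - x0|\<^sup>2\<close>.\<close>

lemma smooth_bump_exists:
  fixes x0 :: "'e::euclidean_space"
  assumes "r > 0"
  obtains b :: "'e \<Rightarrow> real" where "smooth_on UNIV b" "b x0 = 1" "\<And>x. x \<notin> cball x0 r \<Longrightarrow> b x = 0"
proof
  \<comment> \<open>The squared distance as a polynomial in the coordinates, in the form that the closure lemmas accept.\<close>
  define q where "q x = r\<^sup>2 + (\<Sum>i\<in>Basis. (-1) * ((x \<bullet> i + - (x0 \<bullet> i)) * (x \<bullet> i + - (x0 \<bullet> i))))" for x
  define c where "c = flat_exp 0 (r\<^sup>2)"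
  have q_eq: "q x = r\<^sup>2 - (dist x0 x)\<^sup>2" for x
  proof -
    have "(dist x0 x)\<^sup>2 = (\<Sum>i\<in>Basis. ((x0 - x) \<bullet> i) * ((x0 - x) \<bullet> i))"
      unfolding dist_norm power2_norm_eq_inner by (rule euclidean_inner)
    also have "\<dots> = (\<Sum>i\<in>Basis. (x \<bullet> i + - (x0 \<bullet> i)) * (x \<bullet> i + - (x0 \<bullet> i)))"
      by (intro sum.cong) (simp_all add: inner_diff_left algebra_simps)
    finally show ?thesis by (simp add: q_def sum_negf)
  qed
  have c: "c \<noteq> 0" using assms by (simp add: c_def flat_exp_def)
  have "C_k_on k UNIV q" for k
    unfolding q_def
    by (intro C_k_on_add C_k_on_sum C_k_on_mult C_k_on_const open_UNIV finite_Basis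
        C_k_on_bounded_linear bounded_linear_inner_left)
  then have "C_k_on k UNIV (\<lambda>x. flat_exp 0 (q x))" for k
    by (rule C_k_on_compose[OF open_UNIV subset_UNIV C_k_on_flat_exp])
  then have "C_k_on k UNIV (\<lambda>x. inverse c * flat_exp 0 (q x))" for k
    by (rule C_k_on_mult[OF open_UNIV C_k_on_const])
  then show "smooth_on UNIV (\<lambda>x. inverse c * flat_exp 0 (q x))" by (simp add: smooth_on_def)
  show "inverse c * flat_exp 0 (q x0) = 1" using c by (simp add: q_eq c_def)
  show "inverse c * flat_exp 0 (q x) = 0" if "x \<notin> cball x0 r" for x
  proof -
    have "r\<^sup>2 < (dist x0 x)\<^sup>2" using that assms by (intro power_strict_mono) auto
    then show ?thesis by (simp add: q_eq flat_exp_def)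
  qed
qed

section \<open>Extending tangent vectors to vector fields\<close>

lemma smooth_atlasD:
  assumes "smooth_atlas A" "(U, \<psi>) \<in> A"
  shows "open U" "open (\<psi> ` U)" "inj_on \<psi> U" "homeomorphism U (\<psi> ` U) \<psi> (inv_into U \<psi>)"
proof -
  have "\<forall>(U, \<psi>)\<in>A. open U \<and> open (\<psi> ` U) \<and> inj_on \<psi> U \<and> homeomorphism U (\<psi> ` U) \<psi> (inv_into U \<psi>)"
    using assms(1) by (simp add: smooth_atlas_def)
  from bspec[OF this assms(2)]
  show "open U" "open (\<psi> ` U)" "inj_on \<psi> U" "homeomorphism U (\<psi> ` U) \<psi> (inv_into U \<psi>)"
    by simp_all
qed

lemma smooth_atlas_covers:
  assumes "smooth_atlas A"
  obtains U \<psi> where "(U, \<psi>) \<in> A" "p \<in> U"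
proof -
  have "p \<in> (\<Union>(U, \<psi>)\<in>A. U)" using assms by (simp add: smooth_atlas_def)
  then show ?thesis by (auto intro: that)
qed

lemma smooth_atlas_transition:
  assumes "smooth_atlas A" "(U, \<psi>) \<in> A" "(V, \<theta>) \<in> A"
  shows "smooth_on (\<psi> ` (U \<inter> V)) (\<theta> \<circ> inv_into U \<psi>)"
proof -
  have "\<forall>(U, \<psi>)\<in>A. \<forall>(V, \<theta>)\<in>A. smooth_on (\<psi> ` (U \<inter> V)) (\<theta> \<circ> inv_into U \<psi>)"
    using assms(1) by (simp add: smooth_atlas_def)
  from bspec[OF this assms(2)] show ?thesis using assms(3) by auto
qed

lemma open_chart_image:
  assumes "smooth_atlas A" "(U, \<psi>) \<in> A" "open W" "W \<subseteq> U"
  shows "open (\<psi> ` W)"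
proof -
  note U = smooth_atlasD[OF assms(1,2)]
  have "\<psi> ` W = \<psi> ` U \<inter> inv_into U \<psi> -` W"
    using assms(4) U(3) by (force simp: subset_iff)
  moreover have "continuous_on (\<psi> ` U) (inv_into U \<psi>)"
    using U(4) by (auto simp: homeomorphism_def)
  ultimately show ?thesis
    using U(2) assms(3) by (metis continuous_on_open_vimage Int_commute)
qed

lemma smooth_functions_mult:
  assumes "smooth_atlas A" "f \<in> smooth_functions A" "h \<in> smooth_functions A"
  shows "(\<lambda>p. f p * h p) \<in> smooth_functions A"
  unfolding smooth_functions_def
proof (clarsimp)
  fix U \<psi> assume "(U, \<psi>) \<in> A"
  then have "smooth_on (\<psi> ` U) (\<lambda>x. (f \<circ> inv_into U \<psi>) x * (h \<circ> inv_into U \<psi>) x)"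
    by (intro smooth_on_mult smooth_atlasD[OF assms(1)])
       (use assms(2,3) in \<open>auto simp: smooth_functions_def simp del: comp_apply\<close>)
  then show "smooth_on (\<psi> ` U) ((\<lambda>p. f p * h p) \<circ> inv_into U \<psi>)"
    by (simp add: comp_def)
qed

text \<open>In another chart, the extension is a composition with a transition map on the overlap and is 0
  off the preimage \<open>C\<close> of \<open>K\<close>. These two sets cover the chart, and both are open: \<open>C\<close> is compact, hence closed
  because the manifold is Hausdorff.\<close>

lemma smooth_extension_by_zero:
  fixes A :: "('a::{t2_space, second_countable_topology}, 'e::euclidean_space) chart set"
  assumes A: "smooth_atlas A" and U: "(U, \<psi>) \<in> A"
    and K: "compact K" "K \<subseteq> \<psi> ` U"
    and G: "smooth_on (\<psi> ` U) G" "\<And>x. x \<in> \<psi> ` U \<Longrightarrow> x \<notin> K \<Longrightarrow> G x = 0"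
  shows "(\<lambda>q. if q \<in> U then G (\<psi> q) else 0) \<in> smooth_functions A"
proof -
  define f where "f = (\<lambda>q. if q \<in> U then G (\<psi> q) else 0)"
  note U' = smooth_atlasD[OF A U]
  define C where "C = inv_into U \<psi> ` K"
  have "continuous_on (\<psi> ` U) (inv_into U \<psi>)"
    using U'(4) by (auto simp: homeomorphism_def)
  then have "compact C"
    unfolding C_def using K continuous_on_subset by (blast intro: compact_continuous_image)
  then have "closed C" by (rule compact_imp_closed)
  have f0: "f q = 0" if "q \<notin> C" for q
  proof (cases "q \<in> U")
    case True
    with that have "\<psi> q \<notin> K" unfolding C_def using U'(3) by (metis image_eqI inv_into_f_f)
    then show ?thesis using G(2) True by (auto simp: f_def)
  qed (simp add: f_def)
  have CU: "C \<subseteq> U" using K(2) by (auto simp: C_def intro: inv_into_into)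
  have "C_k_on k (\<theta> ` V) (f \<circ> inv_into V \<theta>)" if V: "(V, \<theta>) \<in> A" for V \<theta> k
  proof -
    note V' = smooth_atlasD[OF A V]
    have o1: "open (\<theta> ` (V \<inter> U))" and o2: "open (\<theta> ` (V - C))"
      using V'(1) U'(1) \<open>closed C\<close> by (auto intro!: open_chart_image[OF A V])
    have "C_k_on k (\<theta> ` (V \<inter> U)) (\<lambda>x. G ((\<psi> \<circ> inv_into V \<theta>) x))"
    proof (rule C_k_on_compose[OF o1, where S' = "\<psi> ` U"])
      show "(\<psi> \<circ> inv_into V \<theta>) ` \<theta> ` (V \<inter> U) \<subseteq> \<psi> ` U"
        using V'(3) by auto
    qed (use G(1) smooth_atlas_transition[OF A V U] in \<open>auto simp: smooth_on_def simp del: comp_apply\<close>)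
    then have 1: "C_k_on k (\<theta> ` (V \<inter> U)) (f \<circ> inv_into V \<theta>)"
      by (rule C_k_on_cong[OF o1]) (use V'(3) in \<open>auto simp: f_def\<close>)
    have 2: "C_k_on k (\<theta> ` (V - C)) (f \<circ> inv_into V \<theta>)"
      by (rule C_k_on_cong[OF o2 C_k_on_const[where c = 0]]) (use V'(3) f0 in auto)
    have "\<theta> ` V = \<theta> ` (V \<inter> U) \<union> \<theta> ` (V - C)" using CU by auto
    then show ?thesis using C_k_on_Un[OF o1 o2 1 2] by simp
  qed
  then show ?thesis unfolding smooth_functions_def f_def[symmetric] by (auto simp: smooth_on_def)
qed

lemma tangent_spaceI:
  assumes "(U, \<psi>) \<in> A" "p \<in> U" "\<And>f. f \<notin> smooth_functions A \<Longrightarrow> v f = 0"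
    "\<And>f. f \<in> smooth_functions A \<Longrightarrow> v f = frechet_derivative (f \<circ> inv_into U \<psi>) (at (\<psi> p)) w"
  shows "v \<in> tangent_space A p"
  using assms unfolding tangent_space_def by (auto intro!: bexI[of _ "(U, \<psi>)"] exI[of _ w])

text \<open>A tangent vector is a directional derivative in some chart; differentiate in the same direction at
  every point of the chart and multiply by a bump function.\<close>

lemma tangent_vector_extends:
  fixes A :: "('a::{t2_space, second_countable_topology}, 'e::euclidean_space) chart set"
  assumes A: "smooth_atlas A" and v: "v \<in> tangent_space A p"
  obtains X where "X \<in> vector_fields A" "X p = v"
proof -
  from v obtain U \<psi> w where U: "(U, \<psi>) \<in> A" "p \<in> U"
    and v0: "\<And>f. f \<notin> smooth_functions A \<Longrightarrow> v f = 0"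
    and vf: "\<And>f. f \<in> smooth_functions A \<Longrightarrow>
        v f = frechet_derivative (f \<circ> inv_into U \<psi>) (at (\<psi> p)) w"
    unfolding tangent_space_def by blast
  note U' = smooth_atlasD[OF A U(1)]
  have "\<psi> p \<in> \<psi> ` U" using U(2) by simp
  then obtain r where r: "r > 0" "cball (\<psi> p) r \<subseteq> \<psi> ` U"
    using U'(2) open_contains_cball by blast
  obtain b :: "'e \<Rightarrow> real" where b: "smooth_on UNIV b" "b (\<psi> p) = 1"
    "\<And>x. x \<notin> cball (\<psi> p) r \<Longrightarrow> b x = 0"
    using smooth_bump_exists[OF r(1)] by blast
  define X where "X = (\<lambda>q f. if q \<in> U \<and> f \<in> smooth_functions A
    then b (\<psi> q) * frechet_derivative (f \<circ> inv_into U \<psi>) (at (\<psi> q)) w else 0)"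
  have sm: "smooth_on (\<psi> ` U) (f \<circ> inv_into U \<psi>)" if "f \<in> smooth_functions A" for f
    using that U(1) by (auto simp: smooth_functions_def)
  have lin: "linear (frechet_derivative (f \<circ> inv_into V \<theta>) (at (\<theta> q)))"
    if "f \<in> smooth_functions A" "(V, \<theta>) \<in> A" "q \<in> V" for f V \<theta> q
  proof -
    have "smooth_on (\<theta> ` V) (f \<circ> inv_into V \<theta>)" using that by (auto simp: smooth_functions_def)
    from smooth_on_has_derivative[OF this, of "\<theta> q"] that(3) show ?thesis
      by (auto intro: has_derivative_linear)
  qed
  have "X q \<in> tangent_space A q" for q
  proof (cases "q \<in> U")
    case True
    have "X q f = frechet_derivative (f \<circ> inv_into U \<psi>) (at (\<psi> q)) (b (\<psi> q) *\<^sub>R w)"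
      if "f \<in> smooth_functions A" for f
      using True that linear_cmul[OF lin[OF that U(1) True]] by (simp add: X_def)
    then show ?thesis using U(1) True by (intro tangent_spaceI[where w = "b (\<psi> q) *\<^sub>R w"]) (auto simp: X_def)
  next
    case False
    obtain V \<theta> where V: "(V, \<theta>) \<in> A" "q \<in> V" using smooth_atlas_covers[OF A] by blast
    have "X q f = frechet_derivative (f \<circ> inv_into V \<theta>) (at (\<theta> q)) 0"
      if "f \<in> smooth_functions A" for f
      using False linear_0[OF lin[OF that V]] by (simp add: X_def)
    then show ?thesis using V by (intro tangent_spaceI[where w = 0]) (auto simp: X_def)
  qed
  moreover have "lie_deriv X f \<in> smooth_functions A" if f: "f \<in> smooth_functions A" for f
  proof -
    have "smooth_on (\<psi> ` U) (\<lambda>x. b x * frechet_derivative (f \<circ> inv_into U \<psi>) (at x) w)"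
      using b(1) U'(2) sm[OF f]
      by (intro smooth_on_mult smooth_on_directional_derivative)
         (auto simp: smooth_on_def intro: C_k_on_subset)
    from smooth_extension_by_zero[OF A U(1) compact_cball r(2) this] show ?thesis
      using f b(3) by (simp add: lie_deriv_def X_def cong: if_cong)
  qed
  ultimately have "X \<in> vector_fields A" by (simp add: vector_fields_def)
  moreover have "X p = v" using U(2) b(2) v0 vf by (auto simp: X_def fun_eq_iff)
  ultimately show ?thesis by (rule that)
qed

section \<open>The Levi-Civita connection of an almost paracosymplectic manifold\<close>

text \<open>If the constant were not a smooth function, a tangent vector would still send it to 0 by its default
  value, so the charts need not be examined.\<close>

lemma lie_deriv_const:
  assumes "X \<in> vector_fields A"
  shows "lie_deriv X (\<lambda>_. c) p = 0"
proof -
  have "X p \<in> tangent_space A p" using assms by (simp add: vector_fields_def)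
  then show ?thesis
    by (cases "(\<lambda>_. c) \<in> smooth_functions A")
       (auto simp: lie_deriv_def tangent_space_def comp_def)
qed

locale paracosymplectic_levi_civita =
  fixes A :: "('a::{t2_space, second_countable_topology}, 'e::euclidean_space) chart set"
    and n :: nat and \<phi> :: "'a endo" and \<xi> :: "'a vfield" and \<eta> :: "'a form1" and g :: "'a form2"
    and \<alpha> :: "'a \<Rightarrow> real" and D :: "'a connection"
  assumes paracosymplectic: "almost_paracosymplectic A n \<phi> \<xi> \<eta> g \<alpha>"
    and levi_civita: "levi_civita_connection A g D"
begin

lemma paracontact:
  shows atlas: "smooth_atlas A"
    and phi_endo: "endo_field A \<phi>"
    and xi_field: "\<xi> \<in> vector_fields A"
    and eta_form: "one_form A \<eta>"
    and metric: "pseudo_riemannian_metric A g"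
    and signature: "has_signature A g (n + 1) n"
    and eta_xi: "\<eta> p (\<xi> p) = 1"
    and phi_phi: "u \<in> tangent_space A p \<Longrightarrow> \<phi> p (\<phi> p u) = u - \<eta> p u *\<^sub>R \<xi> p"
    and g_phi_phi: "u \<in> tangent_space A p \<Longrightarrow> v \<in> tangent_space A p \<Longrightarrow>
      g p (\<phi> p u) (\<phi> p v) = - g p u v + \<eta> p u * \<eta> p v"
  using paracosymplectic unfolding almost_paracosymplectic_def almost_paracontact_metric_def
  by simp_all

lemma paracosymplectic_equations:
  assumes "X \<in> vector_fields A" "Y \<in> vector_fields A"
  shows d_eta: "d_form1 \<eta> X Y p = 0"
    and d_Phi: "Z \<in> vector_fields A \<Longrightarrow> d_form2 (fundamental_form \<phi> g) X Y Z p =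
      2 * \<alpha> p * wedge12 \<eta> (fundamental_form \<phi> g) p (X p) (Y p) (Z p)"
  using paracosymplectic assms unfolding almost_paracosymplectic_def by simp_all

lemma levi_civita_connection:
  assumes "X \<in> vector_fields A" "Y \<in> vector_fields A"
  shows nabla_field: "D X Y \<in> vector_fields A"
    and nabla_add: "Z \<in> vector_fields A \<Longrightarrow> D X (Y + Z) = D X Y + D X Z"
    and nabla_fscale: "f \<in> smooth_functions A \<Longrightarrow>
      D X (fscale f Y) = fscale (lie_deriv X f) Y + fscale f (D X Y)"
    and torsion: "D X Y - D Y X = lie_bracket X Y"
    and metric_compatible: "Z \<in> vector_fields A \<Longrightarrow>
      lie_deriv X (app2 g Y Z) p = g p (D X Y p) (Z p) + g p (Y p) (D X Z p)"
  using levi_civita assms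
  unfolding levi_civita_connection_def affine_connection_def app2_def by simp_all

subsection \<open>Pointwise algebra\<close>

text \<open>A sum of two tangent vectors may involve two charts. The pseudo-orthonormal bases spare the comparison
  of charts: each tangent space is a span.\<close>

lemma subspace_tangent: "subspace (tangent_space A p)"
proof -
  from signature obtain b :: "nat \<Rightarrow> 'a tvec" where "span (b ` {..<n + 1 + n}) = tangent_space A p"
    unfolding has_signature_def by blast
  then show ?thesis by (metis subspace_span)
qed

lemmas tangent_add = subspace_add[OF subspace_tangent]
  and tangent_diff = subspace_diff[OF subspace_tangent]
  and tangent_scale = subspace_scale[OF subspace_tangent]
  and tangent_neg = subspace_neg[OF subspace_tangent]

lemma vector_field_tangent: "X \<in> vector_fields A \<Longrightarrow> X p \<in> tangent_space A p"
  by (simp add: vector_fields_def)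

lemma xi_tangent: "\<xi> p \<in> tangent_space A p" by (rule vector_field_tangent[OF xi_field])

lemma linear_on_space_diff:
  assumes "linear_on_space (tangent_space A p) L" "u \<in> tangent_space A p" "v \<in> tangent_space A p"
  shows "L (u - v) = L u - L v"
proof -
  have "L (u - v) + L v = L u"
    using assms tangent_diff[OF assms(2,3)] unfolding linear_on_space_def
    by (metis diff_add_cancel)
  then show ?thesis by (simp add: algebra_simps)
qed

lemma phi_linear: "linear_on_space (tangent_space A p) (\<phi> p)"
  using phi_endo by (simp add: endo_field_def)

lemma phi_tangent: "u \<in> tangent_space A p \<Longrightarrow> \<phi> p u \<in> tangent_space A p"
  using phi_endo by (auto simp: endo_field_def)

lemma eta_linear: "linear_on_space (tangent_space A p) (\<eta> p)"
  using eta_form by (simp add: one_form_def)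

lemma g_linear: "u \<in> tangent_space A p \<Longrightarrow> linear_on_space (tangent_space A p) (g p u)"
  using metric by (simp add: pseudo_riemannian_metric_def)

lemma g_sym: "u \<in> tangent_space A p \<Longrightarrow> v \<in> tangent_space A p \<Longrightarrow> g p u v = g p v u"
  using metric by (simp add: pseudo_riemannian_metric_def)

lemma g_nondegenerate:
  "u \<in> tangent_space A p \<Longrightarrow> (\<And>v. v \<in> tangent_space A p \<Longrightarrow> g p u v = 0) \<Longrightarrow> u = 0"
  using metric by (simp add: pseudo_riemannian_metric_def)

lemma phi_diff: "u \<in> tangent_space A p \<Longrightarrow> v \<in> tangent_space A p \<Longrightarrow> \<phi> p (u - v) = \<phi> p u - \<phi> p v"
  by (rule linear_on_space_diff[OF phi_linear])

lemma phi_scale: "u \<in> tangent_space A p \<Longrightarrow> \<phi> p (c *\<^sub>R u) = c *\<^sub>R \<phi> p u"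
  using phi_linear by (auto simp: linear_on_space_def)

lemma phi_neg: "u \<in> tangent_space A p \<Longrightarrow> \<phi> p (- u) = - \<phi> p u"
  using phi_scale[of u p "-1"] by simp

lemma g_scale_right:
  "u \<in> tangent_space A p \<Longrightarrow> v \<in> tangent_space A p \<Longrightarrow> g p u (c *\<^sub>R v) = c * g p u v"
  using g_linear by (auto simp: linear_on_space_def)

lemma g_scale_left:
  "u \<in> tangent_space A p \<Longrightarrow> v \<in> tangent_space A p \<Longrightarrow> g p (c *\<^sub>R v) u = c * g p v u"
  using g_scale_right g_sym tangent_scale by metis

lemma g_diff_right:
  "u \<in> tangent_space A p \<Longrightarrow> v \<in> tangent_space A p \<Longrightarrow> w \<in> tangent_space A p \<Longrightarrow>
    g p u (v - w) = g p u v - g p u w"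
  using linear_on_space_diff[OF g_linear] .

lemma g_diff_left:
  "u \<in> tangent_space A p \<Longrightarrow> v \<in> tangent_space A p \<Longrightarrow> w \<in> tangent_space A p \<Longrightarrow>
    g p (v - w) u = g p v u - g p w u"
  using g_diff_right g_sym tangent_diff by metis

lemma g_add_left:
  assumes "u \<in> tangent_space A p" "v \<in> tangent_space A p" "w \<in> tangent_space A p"
  shows "g p (v + w) u = g p v u + g p w u"
proof -
  have "g p u (v + w) = g p u v + g p u w"
    using g_linear[OF assms(1)] assms by (simp add: linear_on_space_def)
  then show ?thesis using assms tangent_add g_sym by metis
qed

lemmas g_left = g_add_left g_diff_left g_scale_left
  and g_right = g_diff_right g_scale_right

lemma xi_nonzero: "\<xi> p \<noteq> 0"
  using eta_xi[of p] eta_linear[of p] xi_tangent[of p] unfolding linear_on_space_def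
  by (metis mult_zero_left real_scaleR_def scaleR_zero_left zero_neq_one)

text \<open>Both sides are \<open>\<phi>u - \<phi>\<^sup>3u\<close>, with \<open>\<phi>\<^sup>3\<close> read as \<open>\<phi>(\<phi>\<^sup>2u)\<close> or as \<open>\<phi>\<^sup>2(\<phi>u)\<close>. The identities \<open>\<phi>\<xi> = 0\<close> and \<open>\<eta> \<circ> \<phi> = 0\<close>
  follow from this one.\<close>

lemma phi_xi_proportional:
  assumes u: "u \<in> tangent_space A p"
  shows "\<eta> p u *\<^sub>R \<phi> p (\<xi> p) = \<eta> p (\<phi> p u) *\<^sub>R \<xi> p"
proof -
  have "\<phi> p (\<phi> p (\<phi> p u)) = \<phi> p u - \<eta> p u *\<^sub>R \<phi> p (\<xi> p)"
    using phi_phi[OF u] phi_diff[OF u tangent_scale[OF xi_tangent]] phi_scale[OF xi_tangent] by simp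
  with phi_phi[OF phi_tangent[OF u]] show ?thesis by simp
qed

lemma phi_xi: "\<phi> p (\<xi> p) = 0"
proof -
  define c where "c = \<eta> p (\<phi> p (\<xi> p))"
  have e: "\<phi> p (\<xi> p) = c *\<^sub>R \<xi> p"
    using phi_xi_proportional[OF xi_tangent, of p] eta_xi by (simp add: c_def)
  have "c *\<^sub>R c *\<^sub>R \<xi> p = \<phi> p (\<phi> p (\<xi> p))"
    using e phi_scale[OF xi_tangent, of p c] by simp
  also have "\<dots> = 0" using phi_phi[OF xi_tangent, of p] eta_xi by simp
  finally have "c = 0" using xi_nonzero by simp
  with e show ?thesis by simp
qed

lemma eta_phi: "u \<in> tangent_space A p \<Longrightarrow> \<eta> p (\<phi> p u) = 0"
  using phi_xi_proportional[of u p] phi_xi xi_nonzero by simp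

lemma zero_tangent: "0 \<in> tangent_space A p" by (rule subspace_0[OF subspace_tangent])

lemma g_zero: "u \<in> tangent_space A p \<Longrightarrow> g p u 0 = 0 \<and> g p 0 u = 0"
  using g_scale_right[of u p 0 0] g_scale_left[of u p 0 0] zero_tangent by simp

lemma eta_eq_g_xi: "u \<in> tangent_space A p \<Longrightarrow> \<eta> p u = g p u (\<xi> p)"
  using g_phi_phi[of u p "\<xi> p"] xi_tangent phi_xi eta_xi g_zero[OF phi_tangent] by simp

text \<open>Apply the compatibility of \<open>g\<close> and \<open>\<phi>\<close> to \<open>u\<close> and \<open>\<phi>v\<close>. In other words, the fundamental form is alternating.\<close>

lemma g_phi_skew:
  assumes u: "u \<in> tangent_space A p" and v: "v \<in> tangent_space A p"
  shows "g p (\<phi> p u) v = - g p u (\<phi> p v)"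
proof -
  have "g p (\<phi> p u) (\<phi> p (\<phi> p v)) = - g p u (\<phi> p v)"
    using g_phi_phi[OF u phi_tangent[OF v]] eta_phi[OF v] by simp
  moreover have "g p (\<phi> p u) (\<phi> p (\<phi> p v)) = g p (\<phi> p u) v - \<eta> p v * g p (\<phi> p u) (\<xi> p)"
    using phi_tangent[OF u] v xi_tangent tangent_scale by (simp add: phi_phi g_right)
  moreover have "g p (\<phi> p u) (\<xi> p) = 0"
    using eta_eq_g_xi[OF phi_tangent[OF u]] eta_phi[OF u] by simp
  ultimately show ?thesis by simp
qed

subsection \<open>Covariant derivatives\<close>

lemma app_endo_apply: "app_endo \<phi> X p = \<phi> p (X p)"
  by (simp add: app_endo_def)

lemma phi_field: "X \<in> vector_fields A \<Longrightarrow> app_endo \<phi> X \<in> vector_fields A"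
  using phi_endo by (simp add: endo_field_def)

lemma fscale_field:
  assumes f: "f \<in> smooth_functions A" and X: "X \<in> vector_fields A"
  shows "fscale f X \<in> vector_fields A"
proof -
  have "lie_deriv (fscale f X) h \<in> smooth_functions A" if "h \<in> smooth_functions A" for h
  proof -
    have "lie_deriv (fscale f X) h = (\<lambda>p. f p * lie_deriv X h p)"
      by (simp add: lie_deriv_def fscale_def)
    moreover have "\<dots> \<in> smooth_functions A"
      using X that by (intro smooth_functions_mult atlas f) (auto simp: vector_fields_def)
    ultimately show ?thesis by simp
  qed
  then show ?thesis
    using X tangent_scale by (auto simp: vector_fields_def fscale_def)
qed

lemma nabla_tangent:
  "X \<in> vector_fields A \<Longrightarrow> Y \<in> vector_fields A \<Longrightarrow> D X Y p \<in> tangent_space A p"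
  by (intro vector_field_tangent nabla_field)

lemma torsion_free:
  assumes "X \<in> vector_fields A" "Y \<in> vector_fields A"
  shows "lie_bracket X Y p = D X Y p - D Y X p"
  using fun_cong[OF torsion[OF assms], of p] by simp

text \<open>Differentiate \<open>g(\<xi>, \<xi>) = 1\<close>.\<close>

lemma nabla_xi_orthogonal:
  assumes X: "X \<in> vector_fields A"
  shows "g p (D X \<xi> p) (\<xi> p) = 0"
proof -
  have "app2 g \<xi> \<xi> = (\<lambda>_. 1)"
    using eta_eq_g_xi[OF xi_tangent] eta_xi by (simp add: app2_def)
  then have "g p (D X \<xi> p) (\<xi> p) + g p (\<xi> p) (D X \<xi> p) = 0"
    using metric_compatible[OF X xi_field xi_field, of p] lie_deriv_const[OF X] by simp
  then show ?thesis using g_sym[OF xi_tangent nabla_tangent[OF X xi_field]] by simp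
qed

text \<open>The antisymmetric part of this bilinear form in \<open>X\<close> and \<open>Y\<close> is \<open>d\<eta>\<close>, because \<open>\<eta>\<close> is dual to \<open>\<xi>\<close> and the
  connection is metric and torsion-free.\<close>

lemma nabla_xi_symmetric:
  assumes X: "X \<in> vector_fields A" and Y: "Y \<in> vector_fields A"
  shows "g p (D X \<xi> p) (Y p) = g p (D Y \<xi> p) (X p)"
proof -
  note T = nabla_tangent vector_field_tangent xi_tangent xi_field X Y
  have "app1 \<eta> Z = app2 g Z \<xi>" if "Z \<in> vector_fields A" for Z
    using eta_eq_g_xi[OF vector_field_tangent[OF that]] by (simp add: app1_def app2_def)
  moreover have "\<eta> p (lie_bracket X Y p) = g p (D X Y p) (\<xi> p) - g p (D Y X p) (\<xi> p)"
    using T by (simp add: torsion_free eta_eq_g_xi tangent_diff g_left)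
  moreover have "d_form1 \<eta> X Y p = 0" using X Y by (rule d_eta)
  ultimately have "g p (Y p) (D X \<xi> p) = g p (X p) (D Y \<xi> p)"
    using T by (simp add: d_form1_def metric_compatible) (simp add: app1_def)
  then show ?thesis using T g_sym by metis
qed

lemma nabla_xi_xi: "D \<xi> \<xi> p = 0"
proof (rule g_nondegenerate[OF nabla_tangent[OF xi_field xi_field]])
  fix v assume "v \<in> tangent_space A p"
  then obtain X where X: "X \<in> vector_fields A" "X p = v"
    using tangent_vector_extends[OF atlas] by blast
  have "g p (D \<xi> \<xi> p) (X p) = g p (D X \<xi> p) (\<xi> p)"
    by (rule nabla_xi_symmetric[OF xi_field X(1)])
  then show "g p (D \<xi> \<xi> p) v = 0" using nabla_xi_orthogonal X by simp
qed

definition g_nabla_xi_phi :: "'a vfield \<Rightarrow> 'a vfield \<Rightarrow> 'a \<Rightarrow> real" where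
  "g_nabla_xi_phi Y Z p = g p (cov_deriv_endo D \<xi> \<phi> Y p) (Z p)"

lemma g_nabla_xi_phi_eq:
  assumes Y: "Y \<in> vector_fields A" and Z: "Z \<in> vector_fields A"
  shows "g_nabla_xi_phi Y Z p = g p (D \<xi> (app_endo \<phi> Y) p) (Z p) + g p (D \<xi> Y p) (app_endo \<phi> Z p)"
  using Y Z xi_field phi_field
  by (simp add: g_nabla_xi_phi_def cov_deriv_endo_def app_endo_apply g_left phi_tangent g_phi_skew
      nabla_tangent vector_field_tangent)

text \<open>By \<open>g_nabla_xi_phi_eq\<close>, the left-hand side is \<open>g(\<nabla>\<^sub>\<xi>(\<phi>\<^sup>2Y), \<phi>Z) + g(\<nabla>\<^sub>\<xi>(\<phi>Y), \<phi>\<^sup>2Z)\<close>. Both occurrences of \<open>\<phi>\<^sup>2\<close>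
  can be dropped: the difference is a multiple of \<open>\<xi>\<close>, also after differentiation since \<open>\<nabla>\<^sub>\<xi>\<xi> = 0\<close>, and
  \<open>\<xi>\<close> is orthogonal to \<open>\<phi>Z\<close> and to \<open>\<nabla>\<^sub>\<xi>(\<phi>Y)\<close>.\<close>

lemma g_nabla_xi_phi_invariant:
  assumes Y: "Y \<in> vector_fields A" and Z: "Z \<in> vector_fields A"
  shows "g_nabla_xi_phi (app_endo \<phi> Y) (app_endo \<phi> Z) p = g_nabla_xi_phi Y Z p"
proof -
  note T = nabla_tangent vector_field_tangent xi_tangent xi_field Y Z phi_field phi_tangent
    tangent_scale
  have eta: "app1 \<eta> Y \<in> smooth_functions A" using eta_form Y by (simp add: one_form_def)
  have "Y = app_endo \<phi> (app_endo \<phi> Y) + fscale (app1 \<eta> Y) \<xi>"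
    using T by (simp add: fun_eq_iff app_endo_apply fscale_def app1_def phi_phi)
  then have "D \<xi> Y = D \<xi> (app_endo \<phi> (app_endo \<phi> Y) + fscale (app1 \<eta> Y) \<xi>)" by (rule arg_cong)
  also have "\<dots> = D \<xi> (app_endo \<phi> (app_endo \<phi> Y)) + D \<xi> (fscale (app1 \<eta> Y) \<xi>)"
    by (intro nabla_add xi_field phi_field Y fscale_field eta)
  also have "D \<xi> (fscale (app1 \<eta> Y) \<xi>) =
      fscale (lie_deriv \<xi> (app1 \<eta> Y)) \<xi> + fscale (app1 \<eta> Y) (D \<xi> \<xi>)"
    by (intro nabla_fscale xi_field eta)
  finally have "D \<xi> Y = D \<xi> (app_endo \<phi> (app_endo \<phi> Y)) +
      (fscale (lie_deriv \<xi> (app1 \<eta> Y)) \<xi> + fscale (app1 \<eta> Y) (D \<xi> \<xi>))" .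
  from fun_cong[OF this, of p]
  have "D \<xi> Y p = D \<xi> (app_endo \<phi> (app_endo \<phi> Y)) p + lie_deriv \<xi> (app1 \<eta> Y) p *\<^sub>R \<xi> p"
    by (simp add: fscale_def nabla_xi_xi)
  then have "g p (D \<xi> Y p) (\<phi> p (Z p)) = g p (D \<xi> (app_endo \<phi> (app_endo \<phi> Y)) p) (\<phi> p (Z p))"
    using T eta_eq_g_xi[OF phi_tangent, of "Z p" p] eta_phi[of "Z p" p] g_sym[of "\<xi> p" p "\<phi> p (Z p)"]
    by (simp add: g_left)
  moreover have "g p (D \<xi> (app_endo \<phi> Y) p) (\<xi> p) = 0"
  proof -
    have "app2 g (app_endo \<phi> Y) \<xi> = (\<lambda>_. 0)"
      using T eta_phi eta_eq_g_xi[OF phi_tangent] by (fastforce simp: app2_def app_endo_apply)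
    then have "g p (D \<xi> (app_endo \<phi> Y) p) (\<xi> p) + g p (app_endo \<phi> Y p) (D \<xi> \<xi> p) = 0"
      using metric_compatible[OF xi_field phi_field[OF Y] xi_field, of p] lie_deriv_const[OF xi_field]
      by simp
    then show ?thesis using T g_zero nabla_xi_xi by simp
  qed
  ultimately show ?thesis
    using T by (simp add: g_nabla_xi_phi_eq) (simp add: app_endo_apply phi_phi g_right)
qed

text \<open>Since \<open>\<Phi>(\<xi>, -) = 0\<close>, the formula for \<open>d\<Phi>(\<xi>, Y, Z)\<close> keeps \<open>\<xi>(\<Phi>(Y, Z))\<close> and the two brackets with \<open>\<xi>\<close>.
  The derivatives of \<open>Y\<close>, \<open>Z\<close> and \<open>\<phi>Y\<close> along \<open>\<xi>\<close> in them make up \<open>\<nabla>\<^sub>\<xi>\<phi>\<close>, and what remains are derivatives of \<open>\<xi>\<close>.\<close>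

lemma d_Phi_along_xi:
  assumes Y: "Y \<in> vector_fields A" and Z: "Z \<in> vector_fields A"
  shows "g_nabla_xi_phi Y Z p - g p (D Y \<xi> p) (app_endo \<phi> Z p) + g p (D Z \<xi> p) (app_endo \<phi> Y p)
    = 2 * \<alpha> p * g p (app_endo \<phi> Y p) (Z p)"
proof -
  let ?\<Phi> = "fundamental_form \<phi> g"
  note T = nabla_tangent vector_field_tangent xi_tangent xi_field Y Z phi_field phi_tangent
  have \<Phi>: "app2 ?\<Phi> V W = app2 g (app_endo \<phi> V) W" for V W
    by (simp add: app2_def app_endo_apply fundamental_form_def)
  have \<Phi>_xi: "app2 g (app_endo \<phi> \<xi>) W = (\<lambda>_. 0)" if "W \<in> vector_fields A" for W
    using that T g_zero by (simp add: app2_def app_endo_apply phi_xi)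
  have \<Phi>_br: "app2 ?\<Phi> (lie_bracket V W) U p = g p (D W V p) (\<phi> p (U p)) - g p (D V W p) (\<phi> p (U p))"
    if "V \<in> vector_fields A" "W \<in> vector_fields A" "U \<in> vector_fields A" for V W U
    using that T tangent_diff
    by (simp add: app2_def fundamental_form_def torsion_free g_phi_skew g_left)
  have "d_form2 ?\<Phi> \<xi> Y Z p = g_nabla_xi_phi Y Z p - g p (D Y \<xi> p) (\<phi> p (Z p)) + g p (D Z \<xi> p) (\<phi> p (Y p))"
    using T g_sym[of "D \<xi> Z p" p "\<phi> p (Y p)"] g_zero
    by (simp add: d_form2_def \<Phi>_br) (simp add: \<Phi> \<Phi>_xi lie_deriv_const metric_compatible
        g_nabla_xi_phi_eq phi_xi app_endo_apply)
  moreover have "d_form2 ?\<Phi> \<xi> Y Z p = 2 * \<alpha> p * wedge12 \<eta> ?\<Phi> p (\<xi> p) (Y p) (Z p)"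
    using xi_field Y Z by (rule d_Phi)
  moreover have "wedge12 \<eta> ?\<Phi> p (\<xi> p) (Y p) (Z p) = g p (\<phi> p (Y p)) (Z p)"
    using T g_zero by (simp add: wedge12_def fundamental_form_def eta_xi phi_xi)
  ultimately show ?thesis by (simp add: app_endo_apply)
qed

text \<open>Add \<open>d_Phi_along_xi\<close> for \<open>Y, Z\<close> and for \<open>\<phi>Y, \<phi>Z\<close>; by symmetry of \<open>g(\<nabla>\<^sub>X\<xi>, Y)\<close> everything cancels except twice
  the term in question.\<close>

lemma g_nabla_xi_phi_zero:
  assumes Y: "Y \<in> vector_fields A" and Z: "Z \<in> vector_fields A"
  shows "g_nabla_xi_phi Y Z p = 0"
proof -
  note T = nabla_tangent vector_field_tangent xi_tangent xi_field phi_field phi_tangent tangent_scale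
  have phi2: "g p (D (app_endo \<phi> V) \<xi> p) (app_endo \<phi> (app_endo \<phi> W) p) = g p (D W \<xi> p) (app_endo \<phi> V p)"
    if V: "V \<in> vector_fields A" and W: "W \<in> vector_fields A" for V W
  proof -
    have "g p (D (app_endo \<phi> V) \<xi> p) (app_endo \<phi> (app_endo \<phi> W) p) = g p (D (app_endo \<phi> V) \<xi> p) (W p)"
      using T V W nabla_xi_orthogonal by (simp add: app_endo_apply phi_phi g_right)
    also have "\<dots> = g p (D W \<xi> p) (app_endo \<phi> V p)"
      by (rule nabla_xi_symmetric[OF phi_field[OF V] W])
    finally show ?thesis .
  qed
  have "g p (app_endo \<phi> (app_endo \<phi> Y) p) (app_endo \<phi> Z p) = - g p (app_endo \<phi> Y p) (Z p)"
    using T Y Z by (simp add: app_endo_apply g_phi_phi eta_phi)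
  then show ?thesis
    using d_Phi_along_xi[OF Y Z, of p] d_Phi_along_xi[OF phi_field[OF Y] phi_field[OF Z], of p]
    by (simp add: g_nabla_xi_phi_invariant phi2 Y Z)
qed

lemma phi_parallel_along_xi:
  assumes Y: "Y \<in> vector_fields A"
  shows "cov_deriv_endo D \<xi> \<phi> Y = 0"
proof
  fix p
  have "cov_deriv_endo D \<xi> \<phi> Y p \<in> tangent_space A p"
    using Y xi_field by (simp add: cov_deriv_endo_def app_endo_apply tangent_diff phi_tangent
      nabla_tangent phi_field vector_field_tangent)
  then have "cov_deriv_endo D \<xi> \<phi> Y p = 0"
  proof (rule g_nondegenerate)
    fix v assume "v \<in> tangent_space A p"
    then obtain Z where "Z \<in> vector_fields A" "Z p = v"
      using tangent_vector_extends[OF atlas] by blast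
    then show "g p (cov_deriv_endo D \<xi> \<phi> Y p) v = 0"
      using g_nabla_xi_phi_zero[OF Y] by (auto simp: g_nabla_xi_phi_def)
  qed
  then show "cov_deriv_endo D \<xi> \<phi> Y p = 0 p" by simp
qed

text \<open>With \<open>\<nabla>\<^sub>\<xi>\<phi> = 0\<close>, \<open>d_Phi_along_xi\<close> is the pairing of this identity with a vector field \<open>Z\<close>.\<close>

lemma shape_operator_anticommutator:
  assumes X: "X \<in> vector_fields A"
  shows "shape_operator D \<xi> (app_endo \<phi> X) + app_endo \<phi> (shape_operator D \<xi> X)
    = fscale (\<lambda>p. - 2 * \<alpha> p) (app_endo \<phi> X)"
proof
  fix p
  note T = nabla_tangent vector_field_tangent xi_tangent xi_field X phi_field phi_tangent
    tangent_scale tangent_neg tangent_diff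
  let ?w = "2 *\<^sub>R \<alpha> p *\<^sub>R \<phi> p (X p) - D (app_endo \<phi> X) \<xi> p - \<phi> p (D X \<xi> p)"
  have "?w = 0"
  proof (rule g_nondegenerate)
    show "?w \<in> tangent_space A p" using T by simp
    fix v assume v: "v \<in> tangent_space A p"
    then obtain Z where Z: "Z \<in> vector_fields A" "Z p = v"
      using tangent_vector_extends[OF atlas] by blast
    have "g p (D (app_endo \<phi> X) \<xi> p) (Z p) = g p (D Z \<xi> p) (app_endo \<phi> X p)"
      by (rule nabla_xi_symmetric[OF phi_field[OF X] Z(1)])
    moreover have "g p (\<phi> p (D X \<xi> p)) (Z p) = - g p (D X \<xi> p) (app_endo \<phi> Z p)"
      using T Z(1) by (simp add: g_phi_skew app_endo_apply)
    ultimately have "2 * \<alpha> p * g p (app_endo \<phi> X p) (Z p) - g p (D (app_endo \<phi> X) \<xi> p) (Z p)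
        - g p (\<phi> p (D X \<xi> p)) (Z p) = 0"
      using d_Phi_along_xi[OF X Z(1), of p] g_nabla_xi_phi_zero[OF X Z(1)] by simp
    then show "g p ?w v = 0"
      using T Z v by (simp add: g_left app_endo_apply)
  qed
  then show "(shape_operator D \<xi> (app_endo \<phi> X) + app_endo \<phi> (shape_operator D \<xi> X)) p
    = fscale (\<lambda>p. - 2 * \<alpha> p) (app_endo \<phi> X) p"
    using T by (simp add: shape_operator_def fscale_def app_endo_apply phi_neg algebra_simps)
qed

end

theorem proposition2:
  fixes A :: "('a::{t2_space, second_countable_topology}, 'e::euclidean_space) chart set"
    and n :: nat and \<phi> :: "'a endo" and \<xi> :: "'a vfield" and \<eta> :: "'a form1" and g :: "'a form2"
    and \<alpha> :: "'a \<Rightarrow> real" and D :: "'a connection"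
  assumes "almost_paracosymplectic A n \<phi> \<xi> \<eta> g \<alpha>"
    and "levi_civita_connection A g D"
  shows "(\<forall>X\<in>vector_fields A.
            shape_operator D \<xi> (app_endo \<phi> X) + app_endo \<phi> (shape_operator D \<xi> X)
              = fscale (\<lambda>p. - 2 * \<alpha> p) (app_endo \<phi> X)) \<and>
         (\<forall>Y\<in>vector_fields A. cov_deriv_endo D \<xi> \<phi> Y = 0)"
proof -
  interpret paracosymplectic_levi_civita A n \<phi> \<xi> \<eta> g \<alpha> D
    using assms by unfold_locales
  show ?thesis using shape_operator_anticommutator phi_parallel_along_xi by blast
qed

end
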